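(* Let $\mathcal T:\mathbb R\to\mathcal P(\mathbb R)$ be a multi-valued operator. Then the following are equivalent: (i) $\mathcal T$ is a maximal monotone operator with domain $\mathbb R$, $0\in\mathcal T(0)$, and $\mathcal T$ is sublinear in the sense that there exist $T_1,T_2\ge0$ such that, for all $x\in\mathbb R$ and all $y\in\mathcal T(x)$, $|y|\le T_1|x|+T_2$; (ii) there exist functions $\zeta,\beta:\mathbb R\to\mathbb R$ such that - $\beta$ is nondecreasing, Lipschitz continuous with some Lipschitz constant $L_\beta>0$, and $\beta(0)=0$; - $\zeta$ is nondecreasing, Lipschitz continuous with some Lipschitz constant $L_\zeta>0$, $\zeta(0)=0$, and there are positive constants $M_1,M_2$ such that $|\zeta(s)|\ge M_1|s|-M_2$ for every $s\in\mathbb R$; - the graph of $\mathcal T$ is $\mathrm{Gr}(\mathcal T)=\{(\zeta(s),\beta(s)):s\in\mathbb R\}$.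
   Context: $\mathcal P(\mathbb R)$ is the power set of $\mathbb R$. The graph of $\mathcal T$ is $\mathrm{Gr}(\mathcal T)=\{(x,y)\in\mathbb R^2: y\in\mathcal T(x)\}$ and its domain is $\{x:\mathcal T(x)\neq\emptyset\}$. $\mathcal T$ is monotone if $(x-x')(y-y')\ge0$ for all $(x,y),(x',y')\in\mathrm{Gr}(\mathcal T)$, and maximal monotone if moreover any $(x,y)\in\mathbb R^2$ with $(x-x')(y-y')\ge0$ for all $(x',y')\in\mathrm{Gr}(\mathcal T)$ belongs to $\mathrm{Gr}(\mathcal T)$. *)

theory Defs
  imports "HOL-Analysis.Analysis"
begin

definition op_graph :: "(real \<Rightarrow> real set) \<Rightarrow> (real \<times> real) set" where
  "op_graph T = {(x, y). y \<in> T x}"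

definition op_domain :: "(real \<Rightarrow> real set) \<Rightarrow> real set" where
  "op_domain T = {x. T x \<noteq> {}}"

definition monotone_op :: "(real \<Rightarrow> real set) \<Rightarrow> bool" where
  "monotone_op T \<longleftrightarrow>
     (\<forall>(x, y) \<in> op_graph T. \<forall>(x', y') \<in> op_graph T. (x - x') * (y - y') \<ge> 0)"

definition maximal_monotone_op :: "(real \<Rightarrow> real set) \<Rightarrow> bool" where
  "maximal_monotone_op T \<longleftrightarrow>
     monotone_op T \<and>
     (\<forall>x y. (\<forall>(x', y') \<in> op_graph T. (x - x') * (y - y') \<ge> 0) \<longrightarrow> (x, y) \<in> op_graph T)"

definition sublinear_op :: "(real \<Rightarrow> real set) \<Rightarrow> bool" where
  "sublinear_op T \<longleftrightarrow>
     (\<exists>T\<^sub>1 T\<^sub>2. T\<^sub>1 \<ge> 0 \<and> T\<^sub>2 \<ge> 0 \<and> (\<forall>x. \<forall>y \<in> T x. \<bar>y\<bar> \<le> T\<^sub>1 * \<bar>x\<bar> + T\<^sub>2))"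

end

theory Submission
  imports Defs
begin

text \<open>
  Both directions rest on Minty's idea of looking at a monotone graph along the antidiagonals
  \<open>x + y = s\<close>. Two monotonically related points lie on the same antidiagonal only if they
  coincide, and more precisely both coordinates are nondecreasing 1-Lipschitz functions of the sum
  (\<open>comonotone_coordinate_bounds\<close>).

  If \<open>T\<close> is maximal monotone with full domain, then its graph meets every antidiagonal
  (\<open>minty_antidiagonal\<close>). Hence the graph is parametrised by \<open>s = x + y\<close>, that is, by the
  resolvent \<open>\<zeta> = (I + T)\<^sup>-\<^sup>1\<close> and its complement \<open>\<beta> = I - \<zeta>\<close>, and the
  sublinear bound \<open>\<bar>s\<bar> \<le> \<bar>x\<bar> + \<bar>y\<bar> \<le> (1 + T\<^sub>1) \<bar>x\<bar> + T\<^sub>2\<close> becomes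
  the coercivity of \<open>\<zeta>\<close>.

  Conversely, for a given parametrisation, \<open>\<zeta>\<close> and \<open>\<zeta> + \<beta>\<close> are continuous and
  coercive, hence surjective (\<open>continuous_coercive_surj\<close>). Surjectivity of \<open>\<zeta>\<close> says that the
  domain is full; surjectivity of \<open>\<zeta> + \<beta>\<close> says that the graph meets every antidiagonal,
  which leaves no room for a further monotonically related point.
\<close>

section \<open>Monotonically related points\<close>

text \<open>The differences of the two coordinates never have opposite signs, so neither can exceed
  their sum. The roles of \<open>x\<close> and \<open>y\<close> are symmetric, so this covers both coordinates.\<close>
lemma comonotone_coordinate_bounds:
  fixes x y x' y' :: real
  assumes "(x - x') * (y - y') \<ge> 0" and "x + y \<le> x' + y'"
  shows "x \<le> x'" and "x' - x \<le> (x' + y') - (x + y)"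
  using assms by (auto simp: zero_le_mult_iff)

lemma comonotone_same_sum:
  fixes x y x' y' :: real
  assumes "(x - x') * (y - y') \<ge> 0" and "x + y = x' + y'"
  shows "x = x'" and "y = y'"
  using assms by (auto simp: zero_le_mult_iff)

lemma monotone_opD:
  assumes "monotone_op T" and "y \<in> T x" and "y' \<in> T x'"
  shows "(x - x') * (y - y') \<ge> 0"
  using assms unfolding monotone_op_def op_graph_def by blast

lemma monotone_op_less:
  assumes "monotone_op T" and "y \<in> T x" and "y' \<in> T x'" and "x < x'"
  shows "y \<le> y'"
  using monotone_opD[OF assms(1-3)] assms(4) by (auto simp: zero_le_mult_iff)

section \<open>From a maximal monotone operator to the parametrisation\<close>

text \<open>One-dimensional Minty theorem. The graph crosses from below to above the antidiagonal
  \<open>x + y = s\<close> at an abscissa \<open>x\<^sub>0\<close>. Approaching \<open>x\<^sub>0\<close> from either side shows that the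
  point of the antidiagonal above \<open>x\<^sub>0\<close> is monotonically related to the whole graph, so
  maximality puts it on the graph.\<close>
lemma minty_antidiagonal:
  assumes max: "maximal_monotone_op T" and dom: "op_domain T = UNIV" and zero: "0 \<in> T 0"
  shows "\<exists>x. s - x \<in> T x"
proof -
  have mon: "monotone_op T"
    using max by (simp add: maximal_monotone_op_def)
  have ne: "\<exists>y. y \<in> T x" for x
    using dom by (auto simp: op_domain_def)
  define A where "A = {x. \<exists>y\<in>T x. x + y \<le> s}"
  define x0 where "x0 = Sup A"
  \<comment> \<open>The graph lies in the quadrants with \<open>x y \<ge> 0\<close>, which yields an element and an upper
    bound of \<open>A\<close>. The shift by 1 makes the abscissa strictly negative, since at \<open>0\<close> itself
    \<open>T\<close> may take positive values.\<close>
  have nonempty: "A \<noteq> {}"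
  proof -
    have "min s 0 - 1 \<in> A"
    proof -
      obtain y where y: "y \<in> T (min s 0 - 1)"
        using ne by blast
      have "y \<le> 0"
        using monotone_op_less[OF mon y zero] by auto
      then show ?thesis
        using y unfolding A_def by (auto intro!: bexI[of _ y])
    qed
    then show ?thesis
      by blast
  qed
  have bound: "x \<le> max s 0" if A: "x \<in> A" for x
  proof (rule ccontr)
    assume "\<not> x \<le> max s 0"
    moreover obtain y where "y \<in> T x" "x + y \<le> s"
      using A unfolding A_def by auto
    ultimately show False
      using monotone_op_less[OF mon zero, of y x] by (auto simp: max_def split: if_splits)
  qed
  have bdd: "bdd_above A"
    using bound by (meson bdd_aboveI)
  have upper: "a \<le> x0" if "a \<in> A" for a
    unfolding x0_def using that bdd by (rule cSup_upper)
  have below: "y \<le> s - x0" if xy: "y \<in> T x" and "x < x0" for x y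
  proof (rule ccontr)
    assume "\<not> y \<le> s - x0"
    then have "max x (s - y) < Sup A"
      using \<open>x < x0\<close> unfolding x0_def by auto
    then obtain a where a: "a \<in> A" "max x (s - y) < a"
      using less_cSup_iff[OF nonempty bdd] by blast
    then obtain z where z: "z \<in> T a" "a + z \<le> s"
      unfolding A_def by blast
    have "y \<le> z"
      using monotone_op_less[OF mon xy z(1)] a by auto
    then show False
      using a z by auto
  qed
  have above: "y \<ge> s - x0" if xy: "y \<in> T x" and "x0 < x" for x y
  proof (rule ccontr)
    assume "\<not> y \<ge> s - x0"
    then have "x0 < min x (s - y)"
      using \<open>x0 < x\<close> by auto
    then obtain a where a: "x0 < a" "a < min x (s - y)"
      using dense by blast
    obtain z where z: "z \<in> T a"
      using ne by blast
    have "a \<notin> A"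
      using upper a by force
    then have "a + z > s"
      using z unfolding A_def by force
    moreover have "z \<le> y"
      using monotone_op_less[OF mon z xy] a by auto
    ultimately show False
      using a by auto
  qed
  have "(x0 - x) * ((s - x0) - y) \<ge> 0" if "y \<in> T x" for x y
  proof (cases x x0 rule: linorder_cases)
    case less
    then show ?thesis
      using below[OF that] by (intro mult_nonneg_nonneg) auto
  next
    case equal
    then show ?thesis
      by simp
  next
    case greater
    then show ?thesis
      using above[OF that] by (intro mult_nonpos_nonpos) auto
  qed
  then have "(x0, s - x0) \<in> op_graph T"
    using max unfolding maximal_monotone_op_def op_graph_def by blast
  then show ?thesis
    unfolding op_graph_def by auto
qed

text \<open>A selection of points of the graph, indexed by their coordinate sums, inherits its
  regularity from \<open>comonotone_coordinate_bounds\<close>. The latter is symmetric in the two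
  coordinates, so this applies to both of them.\<close>
lemma comonotone_sum_param_regular:
  fixes f g :: "real \<Rightarrow> real"
  assumes rel: "\<And>s t. (f s - f t) * (g s - g t) \<ge> 0" and sum: "\<And>s. f s + g s = s"
  shows "mono f" and "1-lipschitz_on UNIV f"
proof -
  have le: "f s \<le> f t \<and> f t - f s \<le> t - s" if "s \<le> t" for s t
    using comonotone_coordinate_bounds[OF rel[of s t]] that by (simp add: sum)
  then show "mono f"
    by (simp add: monoI)
  show "1-lipschitz_on UNIV f"
  proof (rule lipschitz_onI)
    fix s t :: real
    show "dist (f s) (f t) \<le> 1 * dist s t"
      using le[of s t] le[of t s] by (cases "s \<le> t") (auto simp: dist_real_def)
  qed simp
qed

lemma maximal_monotone_parametrisation:
  assumes max: "maximal_monotone_op T" and dom: "op_domain T = UNIV" and zero: "0 \<in> T 0"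
    and sub: "sublinear_op T"
  shows "\<exists>\<zeta> \<beta> :: real \<Rightarrow> real.
    (mono \<beta> \<and> 1-lipschitz_on UNIV \<beta> \<and> \<beta> 0 = 0) \<and>
    (mono \<zeta> \<and> 1-lipschitz_on UNIV \<zeta> \<and> \<zeta> 0 = 0 \<and>
      (\<exists>M\<^sub>1>0. \<exists>M\<^sub>2>0. \<forall>s. \<bar>\<zeta> s\<bar> \<ge> M\<^sub>1 * \<bar>s\<bar> - M\<^sub>2)) \<and>
    op_graph T = {(\<zeta> s, \<beta> s) | s. True}"
proof -
  have mon: "monotone_op T"
    using max by (simp add: maximal_monotone_op_def)
  obtain \<zeta> where \<zeta>: "\<And>s. s - \<zeta> s \<in> T (\<zeta> s)"
    using minty_antidiagonal[OF max dom zero] by metis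
  define \<beta> where "\<beta> s = s - \<zeta> s" for s
  have graph: "\<beta> s \<in> T (\<zeta> s)" and sum: "\<zeta> s + \<beta> s = s" for s
    using \<zeta> by (auto simp: \<beta>_def)
  have eq: "x = \<zeta> (x + y)" "y = \<beta> (x + y)" if "y \<in> T x" for x y
    using comonotone_same_sum[OF monotone_opD[OF mon that graph]] by (simp_all add: sum)
  have rel: "(\<zeta> s - \<zeta> t) * (\<beta> s - \<beta> t) \<ge> 0" for s t
    by (rule monotone_opD[OF mon graph graph])
  have \<zeta>_reg: "mono \<zeta>" "1-lipschitz_on UNIV \<zeta>"
    using comonotone_sum_param_regular[of \<zeta> \<beta>] rel sum by auto
  have \<beta>_reg: "mono \<beta>" "1-lipschitz_on UNIV \<beta>"
    using comonotone_sum_param_regular[of \<beta> \<zeta>] rel sum by (auto simp: mult.commute add.commute)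
  obtain T1 T2 where T: "T1 \<ge> 0" "T2 \<ge> 0" "\<And>x y. y \<in> T x \<Longrightarrow> \<bar>y\<bar> \<le> T1 * \<bar>x\<bar> + T2"
    using sub unfolding sublinear_op_def by blast
  \<comment> \<open>The offset is enlarged by 1 because \<open>T2\<close> may vanish.\<close>
  have growth: "\<bar>\<zeta> s\<bar> \<ge> 1 / (1 + T1) * \<bar>s\<bar> - (T2 + 1) / (1 + T1)" for s
  proof -
    have "\<bar>s\<bar> \<le> \<bar>\<zeta> s\<bar> + \<bar>\<beta> s\<bar>"
      using abs_triangle_ineq[of "\<zeta> s" "\<beta> s"] by (simp add: sum)
    then have "\<bar>s\<bar> - (T2 + 1) \<le> \<bar>\<zeta> s\<bar> * (1 + T1)"
      using T(3)[OF graph[of s]] by (simp add: algebra_simps)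
    then have "(\<bar>s\<bar> - (T2 + 1)) / (1 + T1) \<le> \<bar>\<zeta> s\<bar>"
      using T(1) by (subst pos_divide_le_eq) auto
    then show ?thesis
      by (simp add: diff_divide_distrib)
  qed
  have "0 < 1 / (1 + T1)" "0 < (T2 + 1) / (1 + T1)"
    using T(1,2) by auto
  then have "\<exists>M\<^sub>1>0. \<exists>M\<^sub>2>0. \<forall>s. \<bar>\<zeta> s\<bar> \<ge> M\<^sub>1 * \<bar>s\<bar> - M\<^sub>2"
    using growth by blast
  moreover have "op_graph T = {(\<zeta> s, \<beta> s) | s. True}"
    unfolding op_graph_def using eq graph by blast
  moreover have "\<zeta> 0 = 0" "\<beta> 0 = 0"
    using eq[OF zero] by auto
  ultimately show ?thesis
    using \<zeta>_reg \<beta>_reg by blast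
qed

section \<open>From the parametrisation to a maximal monotone operator\<close>

lemma continuous_coercive_surj:
  fixes g :: "real \<Rightarrow> real"
  assumes cont: "continuous_on UNIV g" and "M\<^sub>1 > 0"
    and right: "\<And>s. s \<ge> 0 \<Longrightarrow> g s \<ge> M\<^sub>1 * s - M\<^sub>2"
    and left: "\<And>s. s \<le> 0 \<Longrightarrow> g s \<le> M\<^sub>1 * s + M\<^sub>2"
  shows "\<exists>s. g s = c"
proof -
  \<comment> \<open>Chosen such that \<open>M\<^sub>1 b - M\<^sub>2 \<ge> \<bar>c\<bar>\<close>.\<close>
  define b where "b = (\<bar>c\<bar> + \<bar>M\<^sub>2\<bar>) / M\<^sub>1"
  have b: "b \<ge> 0" "M\<^sub>1 * b = \<bar>c\<bar> + \<bar>M\<^sub>2\<bar>"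
    using \<open>M\<^sub>1 > 0\<close> by (auto simp: b_def)
  have "g (- b) \<le> c" "c \<le> g b"
    using left[of "- b"] right[of b] b by auto
  then show ?thesis
    using IVT'[of g "- b" c b] b(1) continuous_on_subset[OF cont] by auto
qed

lemma mono_product_nonneg:
  fixes f g :: "real \<Rightarrow> real"
  assumes "mono f" and "mono g"
  shows "(f s - f t) * (g s - g t) \<ge> 0"
  using monoD[OF assms(1), of s t] monoD[OF assms(1), of t s]
    monoD[OF assms(2), of s t] monoD[OF assms(2), of t s]
  by (cases "s \<le> t") (auto intro: mult_nonneg_nonneg mult_nonpos_nonpos)

text \<open>A point monotonically related to the graph shares its antidiagonal with a graph point and
  must therefore be that point: this is the easy half of Minty's characterisation.\<close>
lemma maximal_monotone_opI_antidiagonal: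
  assumes mon: "monotone_op T" and anti: "\<And>s. \<exists>x. s - x \<in> T x"
  shows "maximal_monotone_op T"
  unfolding maximal_monotone_op_def
proof (intro conjI allI impI)
  fix x y
  assume rel: "\<forall>(x', y')\<in>op_graph T. (x - x') * (y - y') \<ge> 0"
  obtain x' where x': "x' + y' = x + y \<Longrightarrow> y' \<in> T x'" for y'
    using anti[of "x + y"] by (metis add_diff_cancel_left')
  have "(x - x') * (y - (x + y - x')) \<ge> 0"
    using bspec[OF rel, of "(x', x + y - x')"] x'[of "x + y - x'"]
    unfolding op_graph_def by simp
  then have "x = x'"
    by (rule comonotone_same_sum) simp
  then show "(x, y) \<in> op_graph T"
    using x' unfolding op_graph_def by simp
qed (rule mon)

lemma parametrised_graph_maximal_monotone:
  fixes \<zeta> \<beta> :: "real \<Rightarrow> real"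
  assumes \<beta>: "mono \<beta>" "L\<^sub>\<beta>-lipschitz_on UNIV \<beta>" "\<beta> 0 = 0"
    and \<zeta>: "mono \<zeta>" "continuous_on UNIV \<zeta>" "\<zeta> 0 = 0"
    and M: "M\<^sub>1 > 0" "M\<^sub>2 > 0" "\<And>s. \<bar>\<zeta> s\<bar> \<ge> M\<^sub>1 * \<bar>s\<bar> - M\<^sub>2"
    and graph: "op_graph T = {(\<zeta> s, \<beta> s) | s. True}"
  shows "maximal_monotone_op T \<and> op_domain T = UNIV \<and> 0 \<in> T 0 \<and> sublinear_op T"
proof -
  have mem: "y \<in> T x \<longleftrightarrow> (\<exists>s. x = \<zeta> s \<and> y = \<beta> s)" for x y
    using graph unfolding op_graph_def by (auto simp: set_eq_iff)
  have cont: "continuous_on UNIV (\<lambda>s. \<zeta> s + \<beta> s)"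
    using \<zeta>(2) lipschitz_on_continuous_on[OF \<beta>(2)] by (intro continuous_intros)
  \<comment> \<open>Monotonicity and \<open>\<zeta> 0 = \<beta> 0 = 0\<close> fix the signs, so the growth of \<open>\<bar>\<zeta>\<bar>\<close>
    becomes a one-sided bound, which adding \<open>\<beta>\<close> only improves.\<close>
  have right: "\<zeta> s \<ge> M\<^sub>1 * s - M\<^sub>2" "\<beta> s \<ge> 0" if "s \<ge> 0" for s
    using M(3)[of s] monoD[OF \<zeta>(1) that] monoD[OF \<beta>(1) that] \<zeta>(3) \<beta>(3) that by auto
  have left: "\<zeta> s \<le> M\<^sub>1 * s + M\<^sub>2" "\<beta> s \<le> 0" if "s \<le> 0" for s
    using M(3)[of s] monoD[OF \<zeta>(1) that] monoD[OF \<beta>(1) that] \<zeta>(3) \<beta>(3) that by auto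
  have surj\<zeta>: "\<exists>s. \<zeta> s = x" for x
    by (rule continuous_coercive_surj[OF \<zeta>(2) M(1) right(1) left(1)])
  have surj_sum: "\<exists>s. \<zeta> s + \<beta> s = c" for c
  proof (rule continuous_coercive_surj[OF cont M(1)])
    show "\<zeta> s + \<beta> s \<ge> M\<^sub>1 * s - M\<^sub>2" if "s \<ge> 0" for s
      using right[OF that] by simp
    show "\<zeta> s + \<beta> s \<le> M\<^sub>1 * s + M\<^sub>2" if "s \<le> 0" for s
      using left[OF that] by simp
  qed
  have "monotone_op T"
    unfolding monotone_op_def graph using mono_product_nonneg[OF \<zeta>(1) \<beta>(1)] by auto
  moreover have "\<exists>x. c - x \<in> T x" for c
    using surj_sum[of c] mem by (metis add_diff_cancel_left')
  ultimately have "maximal_monotone_op T"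
    by (rule maximal_monotone_opI_antidiagonal)
  moreover have "op_domain T = UNIV"
  proof -
    have "T x \<noteq> {}" for x
    proof -
      obtain s where "\<zeta> s = x"
        using surj\<zeta> by blast
      then have "\<beta> s \<in> T x"
        using mem by auto
      then show ?thesis
        by blast
    qed
    then show ?thesis
      unfolding op_domain_def by simp
  qed
  moreover have "0 \<in> T 0"
    unfolding mem using \<zeta>(3) \<beta>(3) by (intro exI[of _ 0]) simp
  moreover have "sublinear_op T"
    unfolding sublinear_op_def
  proof (intro exI conjI allI ballI)
    have L: "L\<^sub>\<beta> \<ge> 0"
      using \<beta>(2) by (rule lipschitz_on_nonneg)
    show "L\<^sub>\<beta> / M\<^sub>1 \<ge> 0" "L\<^sub>\<beta> / M\<^sub>1 * M\<^sub>2 \<ge> 0"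
      using L M(1,2) by auto
    fix x y
    assume "y \<in> T x"
    then obtain s where s: "x = \<zeta> s" "y = \<beta> s"
      using mem by blast
    have "\<bar>y\<bar> \<le> L\<^sub>\<beta> * \<bar>s\<bar>"
      using lipschitz_onD[OF \<beta>(2), of s 0] \<beta>(3) s by (simp add: dist_real_def)
    also have "\<bar>s\<bar> \<le> (\<bar>x\<bar> + M\<^sub>2) / M\<^sub>1"
      using M(3)[of s] M(1) s by (simp add: field_simps)
    then have "L\<^sub>\<beta> * \<bar>s\<bar> \<le> L\<^sub>\<beta> * ((\<bar>x\<bar> + M\<^sub>2) / M\<^sub>1)"
      using L by (rule mult_left_mono)
    also have "\<dots> = L\<^sub>\<beta> / M\<^sub>1 * \<bar>x\<bar> + L\<^sub>\<beta> / M\<^sub>1 * M\<^sub>2"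
      by (simp add: add_divide_distrib distrib_left)
    finally show "\<bar>y\<bar> \<le> L\<^sub>\<beta> / M\<^sub>1 * \<bar>x\<bar> + L\<^sub>\<beta> / M\<^sub>1 * M\<^sub>2" .
  qed
  ultimately show ?thesis
    by blast
qed

section \<open>The equivalence\<close>

theorem lemma3p1:
  fixes T :: "real \<Rightarrow> real set"
  shows "(maximal_monotone_op T \<and> op_domain T = UNIV \<and> 0 \<in> T 0 \<and> sublinear_op T) \<longleftrightarrow>
    (\<exists>\<zeta> \<beta> :: real \<Rightarrow> real.
       (mono \<beta> \<and> (\<exists>L\<^sub>\<beta>>0. L\<^sub>\<beta>-lipschitz_on UNIV \<beta>) \<and> \<beta> 0 = 0) \<and>
       (mono \<zeta> \<and> (\<exists>L\<^sub>\<zeta>>0. L\<^sub>\<zeta>-lipschitz_on UNIV \<zeta>) \<and> \<zeta> 0 = 0 \<and>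
        (\<exists>M\<^sub>1>0. \<exists>M\<^sub>2>0. \<forall>s. \<bar>\<zeta> s\<bar> \<ge> M\<^sub>1 * \<bar>s\<bar> - M\<^sub>2)) \<and>
       op_graph T = {(\<zeta> s, \<beta> s) | s. True})"
    (is "?op \<longleftrightarrow> ?param")
proof
  assume ?op
  then show ?param
    using maximal_monotone_parametrisation[of T] zero_less_one by blast
next
  assume ?param
  then obtain \<zeta> \<beta> L\<^sub>\<beta> L\<^sub>\<zeta> M\<^sub>1 M\<^sub>2 where
    \<beta>: "mono \<beta>" "L\<^sub>\<beta>-lipschitz_on UNIV \<beta>" "\<beta> 0 = 0" and
    \<zeta>: "mono \<zeta>" "L\<^sub>\<zeta>-lipschitz_on UNIV \<zeta>" "\<zeta> 0 = 0" and
    M: "M\<^sub>1 > 0" "M\<^sub>2 > 0" "\<forall>s. \<bar>\<zeta> s\<bar> \<ge> M\<^sub>1 * \<bar>s\<bar> - M\<^sub>2" and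
    graph: "op_graph T = {(\<zeta> s, \<beta> s) | s. True}"
    by (elim exE conjE)
  show ?op
    using parametrised_graph_maximal_monotone[OF \<beta> \<zeta>(1) lipschitz_on_continuous_on[OF \<zeta>(2)]
        \<zeta>(3) M(1,2) M(3)[rule_format] graph] .
qed

end
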